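(* Let $C=(x_1,x_2,\dots,x_{r-1},x_r)$ be a collection of positions, let $a=x_1+x_r$, and let $C^R=(a-x_r,a-x_{r-1},\dots,a-x_1)$. Then $C$ and $C^R$ have the same list of lengths of periods, and thereby the same spectrum kernel.
   Context: A collection of positions is a finite sequence $(x_1,\dots,x_r)$, $r\ge1$, of integers with $0\le x_1<\dots<x_r$. A solution to the recursion defined by $(x_1,\dots,x_r)$ is an infinite $(0,1)$-sequence $T=(T(0),T(1),\dots)$ such that, with $\delta=x_r-x_1$, $T(i)=\sum_{l=2}^{r}T(i-(x_l-x_1)) \pmod 2$ for all $i\ge\delta$ (the first $\delta$ symbols are arbitrary; an empty sum is $0$). Every solution is eventually periodic; a period of $T$ is a non-empty finite word $\pi$ such that $T=\rho\,\pi\pi\pi\cdots$ for some finite (possibly empty) word $\rho$. The lengths of periods of a collection are the lengths of periods of non-zero solutions to its recursion; the set $S$ of these lengths is the spectrum. The spectrum kernel is $K(S)=\{y\in S\mid \forall x\in S\,[x\ne y\Rightarrow x\nmid y]\}$. *)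

theory Defs
  imports Main "HOL-Library.Z2" "HOL-Library.Omega_Words_Fun"
begin

definition is_collection :: "nat list \<Rightarrow> bool" where
  "is_collection C \<longleftrightarrow> C \<noteq> [] \<and> sorted_wrt (<) C"

text \<open>
  Sequences over \<open>{0, 1}\<close> take values in the two-element field \<^typ>\<open>bit\<close>, so the sum below is
  taken modulo 2.  Lists are indexed from 0: \<open>hd C\<close> is \<open>x\<^sub>1\<close> and \<open>C ! l\<close> is the
  \<open>(l+1)\<close>-st position.  No subtraction on naturals is truncated when \<open>C\<close> is a collection, since
  \<open>C ! l - hd C \<le> last C - hd C \<le> i\<close>.
\<close>

definition is_solution :: "nat list \<Rightarrow> (nat \<Rightarrow> bit) \<Rightarrow> bool" where
  "is_solution C T \<longleftrightarrow>
     (\<forall>i \<ge> last C - hd C. T i = (\<Sum>l = 1..<length C. T (i - (C ! l - hd C))))"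

definition is_period :: "bit list \<Rightarrow> (nat \<Rightarrow> bit) \<Rightarrow> bool" where
  "is_period \<pi> T \<longleftrightarrow> \<pi> \<noteq> [] \<and> (\<exists>\<rho>. T = \<rho> \<frown> \<pi>\<^sup>\<omega>)"

definition spectrum :: "nat list \<Rightarrow> nat set" where
  "spectrum C = {length \<pi> |\<pi> T. is_solution C T \<and> T \<noteq> (\<lambda>_. 0) \<and> is_period \<pi> T}"

definition spectrum_kernel :: "nat set \<Rightarrow> nat set" where
  "spectrum_kernel S = {y \<in> S. \<forall>x \<in> S. x \<noteq> y \<longrightarrow> \<not> x dvd y}"

text \<open>
  With \<open>a = x\<^sub>1 + x\<^sub>r\<close> as below, every entry of a collection is at most \<open>a\<close>, so this
  subtraction is not truncated either.
\<close>

definition mirror :: "nat list \<Rightarrow> nat list" where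
  "mirror C = (let a = hd C + last C in map (\<lambda>x. a - x) (rev C))"

lemma collection_le_last:
  assumes "is_collection C" and "x \<in> set C"
  shows "x \<le> last C"
  using assms
  by (cases C rule: rev_cases) (auto simp: is_collection_def sorted_wrt_append)

lemma is_collection_mirror:
  assumes "is_collection C"
  shows "is_collection (mirror C)"
proof -
  let ?a = "hd C + last C"
  have "sorted_wrt (\<lambda>x y. ?a - y < ?a - x) C"
  proof (rule sorted_wrt_mono_rel)
    show "sorted_wrt (<) C" using assms by (simp add: is_collection_def)
  next
    fix x y assume "x \<in> set C" "y \<in> set C" "x < y"
    then show "?a - y < ?a - x"
      using collection_le_last[OF assms, of y] by linarith
  qed
  then show ?thesis
    using assms by (simp add: is_collection_def mirror_def sorted_wrt_map sorted_wrt_rev)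
qed

end

theory Submission
  imports Defs
begin

text \<open>
  Moving all terms to one side, a solution is a sequence with \<open>\<Sum>\<^sub>l T(n + x\<^sub>r - x\<^sub>l) = 0\<close> for all
  \<open>n\<close>.  The term \<open>l = r\<close> is \<open>T(n)\<close>, so the recursion also runs backwards, and an eventually
  periodic solution is periodic from the start.  Reversing time modulo the period \<open>p\<close>, in the
  form \<open>n \<mapsto> (p - 1) n\<close>, then carries solutions for \<open>C\<close> to solutions for its mirror image.
\<close>

lemma
  assumes "is_collection C"
  shows hd_le_nth: "l < length C \<Longrightarrow> hd C \<le> C ! l"
    and nth_le_last: "l < length C \<Longrightarrow> C ! l \<le> last C"
    and nth_less_last: "l < length C - 1 \<Longrightarrow> C ! l < last C"
proof -
  have ne: "C \<noteq> []" and s: "sorted_wrt (<) C"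
    using assms by (auto simp: is_collection_def)
  show "hd C \<le> C ! l" if "l < length C"
    using that ne s by (cases "l = 0") (auto simp: hd_conv_nth sorted_wrt_iff_nth_less less_imp_le)
  show "C ! l \<le> last C" if "l < length C"
    using that collection_le_last[OF assms] by simp
  show "C ! l < last C" if "l < length C - 1"
    using that ne s by (auto simp: last_conv_nth sorted_wrt_iff_nth_less)
qed

lemma bit_add_eq_0_iff: "a + b = 0 \<longleftrightarrow> a = b" for a b :: bit
  by (cases a; cases b) simp_all

text \<open>With \<open>i = n + d\<close> the summand \<open>l = 0\<close> is \<open>T i\<close>
  itself, and in characteristic 2 it changes sides without a sign. Offsets measured from
  \<open>last C\<close> leave no lower bound on \<open>n\<close>.\<close>

lemma is_solution_iff_sum_eq_0:
  assumes "is_collection C"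
  shows "is_solution C T \<longleftrightarrow> (\<forall>n. (\<Sum>l<length C. T (n + (last C - C ! l))) = 0)"
proof -
  define d where "d = last C - hd C"
  have ne: "C \<noteq> []" using assms by (simp add: is_collection_def)
  have split: "(\<Sum>l<length C. T (n + (last C - C ! l)))
      = T (n + d) + (\<Sum>l = 1..<length C. T (n + d - (C ! l - hd C)))" for n
  proof -
    have "(\<Sum>l<length C. T (n + (last C - C ! l))) = (\<Sum>l = 0..<length C. T (n + d - (C ! l - hd C)))"
      unfolding lessThan_atLeast0
    proof (rule sum.cong[OF refl])
      fix l assume "l \<in> {0..<length C}"
      then show "T (n + (last C - C ! l)) = T (n + d - (C ! l - hd C))"
        using hd_le_nth[OF assms, of l] nth_le_last[OF assms, of l] by (simp add: d_def)
    qed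
    also have "\<dots> = T (n + d) + (\<Sum>l = 1..<length C. T (n + d - (C ! l - hd C)))"
      using ne by (simp add: sum.atLeast_Suc_lessThan hd_conv_nth)
    finally show ?thesis .
  qed
  show ?thesis
    unfolding is_solution_def split bit_add_eq_0_iff d_def[symmetric]
    by (metis add.commute le_add2 le_Suc_ex)
qed

lemma
  assumes "is_collection C"
  shows hd_mirror: "hd (mirror C) = hd C"
    and last_mirror: "last (mirror C) = last C"
  using assms by (auto simp: mirror_def Let_def is_collection_def hd_map last_map hd_rev last_rev)

text \<open>Mirroring keeps both end points, so the two reflections subtract from the same
  \<open>hd C + last C\<close> and cancel.\<close>

lemma mirror_mirror:
  assumes "is_collection C"
  shows "mirror (mirror C) = C"
proof -
  have "(hd C + last C) - ((hd C + last C) - x) = x" if "x \<in> set C" for x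
    using collection_le_last[OF assms that] by simp
  then have "map ((-) (hd C + last C)) (map ((-) (hd C + last C)) C) = C"
    by (simp add: map_idI)
  then show ?thesis
    by (simp add: mirror_def[of "mirror C"] hd_mirror[OF assms] last_mirror[OF assms])
       (simp add: mirror_def Let_def rev_map)
qed

text \<open>Entry \<open>l\<close> of the mirror lies as far below \<open>last C\<close> as entry
  \<open>length C - Suc l\<close> of \<open>C\<close> lies above \<open>hd C\<close>; the sum is
  then taken in reverse order.\<close>

lemma is_solution_mirror_iff:
  assumes "is_collection C"
  shows "is_solution (mirror C) T \<longleftrightarrow> (\<forall>n. (\<Sum>l<length C. T (n + (C ! l - hd C))) = 0)"
proof -
  have len: "length (mirror C) = length C"
    by (simp add: mirror_def Let_def)
  have "(\<Sum>l<length C. T (n + (last C - mirror C ! l))) = (\<Sum>l<length C. T (n + (C ! l - hd C)))" for n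
  proof -
    have "(\<Sum>l<length C. T (n + (last C - mirror C ! l)))
        = (\<Sum>l<length C. T (n + (C ! (length C - Suc l) - hd C)))"
    proof (rule sum.cong[OF refl])
      fix l assume "l \<in> {..<length C}"
      then have l: "l < length C" "length C - Suc l < length C" by auto
      then show "T (n + (last C - mirror C ! l)) = T (n + (C ! (length C - Suc l) - hd C))"
        using hd_le_nth[OF assms l(2)] nth_le_last[OF assms l(2)] by (simp add: mirror_def Let_def rev_nth)
    qed
    then show ?thesis
      using sum.nat_diff_reindex[of "\<lambda>l. T (n + (C ! l - hd C))" "length C"] by simp
  qed
  then show ?thesis
    by (simp add: is_solution_iff_sum_eq_0[OF is_collection_mirror[OF assms]] len last_mirror[OF assms])
qed

text \<open>The entry \<open>last C\<close> contributes \<open>T n\<close>; all others are strictly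
  smaller and contribute values at later indices. Hence zeros propagate backwards from
  \<open>N\<close>.\<close>

lemma solution_eventually_0_imp_0:
  assumes C: "is_collection C" and sol: "is_solution C T" and ev: "\<And>i. N \<le> i \<Longrightarrow> T i = 0"
  shows "T n = 0"
proof -
  obtain m where m: "length C = Suc m"
    using C by (cases C) (auto simp: is_collection_def)
  have last: "last C = C ! m"
    using m C by (simp add: last_conv_nth is_collection_def)
  \<comment> \<open>Induction on a bound for the distance to the zero tail; truncated subtraction
    puts every \<open>n \<ge> N\<close> into the case \<open>k = 0\<close>.\<close>
  have "N - n \<le> k \<Longrightarrow> T n = 0" for k
  proof (induction k arbitrary: n)
    case 0
    then show ?case using ev by simp
  next
    case (Suc k)
    have "T (n + (last C - C ! l)) = 0" if "l < m" for l
    proof (rule Suc.IH)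
      show "N - (n + (last C - C ! l)) \<le> k"
        using nth_less_last[OF C, of l] that m Suc.prems by simp
    qed
    moreover have "(\<Sum>l<Suc m. T (n + (last C - C ! l))) = 0"
      using sol m by (simp add: is_solution_iff_sum_eq_0[OF C])
    ultimately show ?case
      by (simp add: last)
  qed
  then show ?thesis by blast
qed

text \<open>Solutions are closed under shifts and sums, so \<open>T (i + p) + T i\<close>, which is
  the difference in characteristic 2, is a solution. It vanishes from \<open>N\<close> on, hence
  everywhere.\<close>

lemma solution_eventually_periodic_imp_periodic:
  assumes C: "is_collection C" and sol: "is_solution C T"
    and ev: "\<And>i. N \<le> i \<Longrightarrow> T (i + p) = T i"
  shows "T (i + p) = T i"
proof -
  have "is_solution C (\<lambda>i. T (i + p) + T i)"
    unfolding is_solution_iff_sum_eq_0[OF C]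
  proof
    fix n
    have "(\<Sum>l<length C. T (n + (last C - C ! l) + p)) = (\<Sum>l<length C. T (n + p + (last C - C ! l)))"
      by (simp add: ac_simps)
    then show "(\<Sum>l<length C. T (n + (last C - C ! l) + p) + T (n + (last C - C ! l))) = 0"
      using sol unfolding sum.distrib by (simp add: is_solution_iff_sum_eq_0[OF C])
  qed
  then have "T (i + p) + T i = 0"
    by (rule solution_eventually_0_imp_0[OF C, where N = N]) (simp add: ev)
  then show ?thesis by (simp only: bit_add_eq_0_iff)
qed

lemma periodic_add_mult:
  fixes T :: "nat \<Rightarrow> 'a"
  assumes "\<And>i. T (i + p) = T i"
  shows "T (i + k * p) = T i"
proof (induction k)
  case (Suc k)
  then show ?case using assms[of "i + k * p"] by (simp add: ac_simps)
qed simp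

text \<open>Periodicity extends backwards over any prefix \<open>\<rho>\<close>, so only pure
  periods remain. Conversely, the first \<open>p\<close> values serve as the period word with empty
  prefix.\<close>

lemma mem_spectrum_iff:
  assumes C: "is_collection C"
  shows "p \<in> spectrum C \<longleftrightarrow>
    p > 0 \<and> (\<exists>T. is_solution C T \<and> T \<noteq> (\<lambda>_. 0) \<and> (\<forall>i. T (i + p) = T i))"
proof
  assume "p \<in> spectrum C"
  then obtain \<pi> T \<rho> where p: "p = length \<pi>" "\<pi> \<noteq> []" and T: "is_solution C T" "T \<noteq> (\<lambda>_. 0)"
    and eq: "T = \<rho> \<frown> \<pi>\<^sup>\<omega>"
    by (auto simp: spectrum_def is_period_def)
  have "T (i + p) = T i" if "length \<rho> \<le> i" for i
    using that p mod_add_self2[of "i - length \<rho>" "length \<pi>"] by (simp add: eq conc_def iter_def)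
  then have "T (i + p) = T i" for i
    by (rule solution_eventually_periodic_imp_periodic[OF C T(1)])
  with p T show "p > 0 \<and> (\<exists>T. is_solution C T \<and> T \<noteq> (\<lambda>_. 0) \<and> (\<forall>i. T (i + p) = T i))"
    by auto
next
  assume "p > 0 \<and> (\<exists>T. is_solution C T \<and> T \<noteq> (\<lambda>_. 0) \<and> (\<forall>i. T (i + p) = T i))"
  then obtain T where p: "p > 0" and T: "is_solution C T" "T \<noteq> (\<lambda>_. 0)"
    and per: "\<And>i. T (i + p) = T i" by blast
  note per_mult = periodic_add_mult[of T p, OF per]
  have "T i = T (i mod p)" for i
    using per_mult[of "i mod p" "i div p"] by simp
  then have "T = [] \<frown> (map T [0..<p])\<^sup>\<omega>"
    using p by (auto simp: iter_def)
  then have "is_period (map T [0..<p]) T"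
    using p unfolding is_period_def by (metis length_map length_upt list.size(3) diff_zero less_numeral_extra(3))
  moreover have "length (map T [0..<p]) = p" by simp
  ultimately show "p \<in> spectrum C"
    unfolding spectrum_def mem_Collect_eq using T by metis
qed

lemma spectrum_subset_spectrum_mirror:
  assumes C: "is_collection C"
  shows "spectrum C \<subseteq> spectrum (mirror C)"
proof
  fix p assume "p \<in> spectrum C"
  then obtain T where p: "p > 0" and T: "is_solution C T" "T \<noteq> (\<lambda>_. 0)"
    and per: "\<And>i. T (i + p) = T i"
    by (auto simp: mem_spectrum_iff[OF C])
  note per_mult = periodic_add_mult[of T p, OF per]
  obtain q where q: "p = Suc q" using p by (cases p) auto
  \<comment> \<open>Since \<open>q = p - 1\<close> is -1 modulo \<open>p\<close>, this is
    \<open>T\<close> at \<open>-n\<close>, kept within the natural numbers.\<close>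
  define U where "U n = T (q * n)" for n
  have "is_solution (mirror C) U"
    unfolding is_solution_mirror_iff[OF C]
  proof
    fix n
    \<comment> \<open>Modulo \<open>p\<close>, both indices are \<open>-n - (C ! l - hd C)\<close>.
      The right side has a base point independent of \<open>l\<close>, so the sum for
      \<open>U\<close> is an instance of the sum for \<open>T\<close>.\<close>
    have "U (n + (C ! l - hd C)) = T (q * (n + (last C - hd C)) + (last C - C ! l))"
      if l: "l < length C" for l
    proof -
      obtain a b where "C ! l = hd C + a" "last C = C ! l + b"
        using hd_le_nth[OF C l] nth_le_last[OF C l] le_Suc_ex by metis
      moreover have "q * (n + a) + b * p = q * (n + (a + b)) + b"
        by (simp add: q algebra_simps)
      ultimately show ?thesis
        using per_mult[of "q * (n + a)" b] by (simp add: U_def)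
    qed
    then show "(\<Sum>l<length C. U (n + (C ! l - hd C))) = 0"
      using T(1) by (simp add: is_solution_iff_sum_eq_0[OF C])
  qed
  moreover have "U \<noteq> (\<lambda>_. 0)"
  proof
    assume U: "U = (\<lambda>_. 0)"
    have "T n = 0" for n
    proof -
      \<comment> \<open>Reversing twice is the identity: \<open>q * q\<close> is 1 modulo
        \<open>p\<close>, so a zero \<open>U\<close> would force a zero \<open>T\<close>.\<close>
      have "q * (q * n) + n * p = n + (n * q) * p"
        by (simp add: q algebra_simps)
      then have "T n = T (q * (q * n))"
        using per_mult by metis
      then show ?thesis
        using U by (simp add: U_def fun_eq_iff)
    qed
    with T(2) show False by auto
  qed
  moreover have "U (i + p) = U i" for i
    using per_mult[of "q * i" q] by (simp add: U_def algebra_simps)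
  ultimately show "p \<in> spectrum (mirror C)"
    using p by (auto simp: mem_spectrum_iff[OF is_collection_mirror[OF C]])
qed

theorem theorem7:
  fixes C :: "nat list"
  assumes "is_collection C"
  shows "spectrum C = spectrum (mirror C) \<and>
         spectrum_kernel (spectrum C) = spectrum_kernel (spectrum (mirror C))"
proof -
  have "spectrum C = spectrum (mirror C)"
    \<comment> \<open>The converse inclusion is the same one applied to \<open>mirror C\<close>,
      whose mirror is \<open>C\<close>.\<close>
    using spectrum_subset_spectrum_mirror[OF assms]
      spectrum_subset_spectrum_mirror[OF is_collection_mirror[OF assms]] mirror_mirror[OF assms]
    by auto
  then show ?thesis by simp
qed

end
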